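(* Let $\Omega\subset\mathbb{R}^n$ be compact, $f\in C(\Omega)$ real-valued with global minimum value $f^*=\min_{x\in\Omega}f(x)$, $\rho:\mathbb{R}\to\mathbb{R}$ monotonically (strictly) decreasing with $\rho(f(x))>0$ for every $x\in\Omega$, $\tau(x)=\rho(f(x))$, and $m^{(k)}(x)=\tau^k(x)/\int_\Omega\tau^k(t)\,\mathrm{d}t$ for $x\in\Omega$, $k\in\mathbb{R}$. For every $k\in\mathbb{R}$, $$\int_\Omega f(x)\,m^{(k)}(x)\,\mathrm{d}x\geqslant f^*,$$ and this is an equality if and only if $f$ is a constant function on $\Omega$.
   Context: Integrals are with respect to $n$-dimensional Lebesgue measure $\mu$; it is implicit in the definition of $m^{(k)}$ that $\mu(\Omega)>0$.
   Formalization: "Equality only if f is constant" fails for Ω=[0,1]∪{2}, f=0 on [0,1], f(2)=1; it is proved when every nonempty relatively open subset of Ω has positive measure. For every Ω, equality is shown to hold iff f=f* almost everywhere on Ω, so "if" holds in general. *)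

theory Defs
  imports "HOL-Analysis.Analysis"
begin

definition tau :: "('a \<Rightarrow> real) \<Rightarrow> (real \<Rightarrow> real) \<Rightarrow> 'a \<Rightarrow> real"
  where "tau f \<rho> x = \<rho> (f x)"

definition min_density ::
  "'a::euclidean_space set \<Rightarrow> ('a \<Rightarrow> real) \<Rightarrow> (real \<Rightarrow> real) \<Rightarrow> real \<Rightarrow> 'a \<Rightarrow> real"
  where "min_density \<Omega> f \<rho> k x = tau f \<rho> x powr k / (LINT t:\<Omega>|lebesgue. tau f \<rho> t powr k)"

(* Every nonempty relatively open subset of \<Omega> has positive measure.  This excludes sets such as
   [0,1] \<union> {2}: a function that is 0 on [0,1] and 1 at 2 is continuous and not constant there,
   but integrates like its minimum 0.  Whenever the condition fails at a point x of a set of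
   positive measure, some bump function around x behaves in the same way. *)
definition full_support :: "'a::euclidean_space set \<Rightarrow> bool"
  where "full_support \<Omega> \<longleftrightarrow>
    (\<forall>U. open U \<and> U \<inter> \<Omega> \<noteq> {} \<longrightarrow> emeasure lebesgue (U \<inter> \<Omega>) > 0)"

end

theory Submission
  imports Defs
begin

text \<open>
  The function \<open>m\<close> is a probability density on \<open>\<Omega>\<close> that is positive everywhere, so the
  difference of both sides is the integral of \<open>(f - fstar) m\<close>, whose integrand is nonnegative: it
  vanishes if and only if \<open>f = fstar\<close> almost everywhere on \<open>\<Omega>\<close>. With full support the relatively
  open set where \<open>f\<close> differs from \<open>fstar\<close> is then empty.
\<close>

text \<open>A nonnegative function with integral zero vanishes almost everywhere. For a positive
  \<open>w\<close> this would make the whole space a null set.\<close>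

lemma integral_pos_of_pos:
  fixes w :: "'a \<Rightarrow> real"
  assumes "integrable M w" "\<And>x. x \<in> space M \<Longrightarrow> w x > 0" "emeasure M (space M) > 0"
  shows "integral\<^sup>L M w > 0"
proof -
  have nn: "AE x in M. 0 \<le> w x"
    using assms(2) by (auto intro!: AE_I2 less_imp_le)
  have "integral\<^sup>L M w \<noteq> 0"
  proof
    assume "integral\<^sup>L M w = 0"
    then have "AE x in M. w x = 0"
      using integral_nonneg_eq_0_iff_AE[OF assms(1) nn] by simp
    with AE_space have "AE x in M. False"
      by eventually_elim (use assms(2) in force)
    then show False
      using assms(3) emeasure_eq_0_AE[of "\<lambda>_. True" M] by simp
  qed
  with integral_nonneg_AE[OF nn] show ?thesis
    by simp
qed

lemma weighted_mean_ge:
  fixes f w :: "'a \<Rightarrow> real"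
  assumes w: "integrable M w" "\<And>x. x \<in> space M \<Longrightarrow> w x > 0" "emeasure M (space M) > 0"
    and fw: "integrable M (\<lambda>x. f x * w x)" and ge: "\<And>x. x \<in> space M \<Longrightarrow> c \<le> f x"
  shows "c \<le> (\<integral>x. f x * (w x / integral\<^sup>L M w) \<partial>M)"
    and "(\<integral>x. f x * (w x / integral\<^sup>L M w) \<partial>M) = c \<longleftrightarrow> (AE x in M. f x = c)"
proof -
  let ?I = "integral\<^sup>L M w" and ?J = "\<integral>x. f x * w x \<partial>M"
  have I: "?I > 0"
    using w by (rule integral_pos_of_pos)
  have mean: "(\<integral>x. f x * (w x / ?I) \<partial>M) = ?J / ?I"
    by simp
  have int: "integrable M (\<lambda>x. f x * w x - c * w x)"
    using w fw by simp
  have diff: "(\<integral>x. f x * w x - c * w x \<partial>M) = ?J - c * ?I"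
    using w fw by simp
  have nn: "AE x in M. 0 \<le> f x * w x - c * w x"
    using w(2) ge by (intro AE_I2) (simp add: mult_right_mono less_imp_le)
  have "0 \<le> ?J - c * ?I"
    using integral_nonneg_AE[OF nn] unfolding diff .
  then show "c \<le> (\<integral>x. f x * (w x / ?I) \<partial>M)"
    unfolding mean using I by (simp add: pos_le_divide_eq)
  have "(\<integral>x. f x * (w x / ?I) \<partial>M) = c \<longleftrightarrow> ?J - c * ?I = 0"
    unfolding mean using I by (simp add: divide_eq_eq)
  also have "\<dots> \<longleftrightarrow> (AE x in M. f x * w x - c * w x = 0)"
    using integral_nonneg_eq_0_iff_AE[OF int nn] unfolding diff .
  \<comment> \<open>The integrand is \<open>(f x - c) * w x\<close> with a positive second factor,
    so both sides describe the same points.\<close>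
  also have "\<dots> \<longleftrightarrow> (AE x in M. f x = c)"
    using w(2) by (intro AE_cong) force
  finally show "(\<integral>x. f x * (w x / ?I) \<partial>M) = c \<longleftrightarrow> (AE x in M. f x = c)" .
qed

text \<open>A decreasing function may jump, so the weight built from it need not be continuous and
  its measurability has to come from monotonicity. Negation reduces this to the increasing
  case.\<close>

lemma borel_measurable_antimono:
  fixes \<rho> :: "real \<Rightarrow> real"
  assumes "antimono \<rho>"
  shows "\<rho> \<in> borel_measurable borel"
proof -
  have "mono (\<lambda>x. - \<rho> x)"
    using assms by (simp add: monotone_def)
  then have "(\<lambda>x. - \<rho> x) \<in> borel_measurable borel"
    by (rule borel_measurable_mono)
  then show ?thesis
    by simp
qed

lemma AE_eq_iff_of_full_support:
  fixes f :: "'a::euclidean_space \<Rightarrow> 'b::t1_space"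
  assumes "full_support \<Omega>" "continuous_on \<Omega> f"
  shows "(AE x in lebesgue. x \<in> \<Omega> \<longrightarrow> f x = c) \<longleftrightarrow> (\<forall>x\<in>\<Omega>. f x = c)"
proof
  assume ae: "AE x in lebesgue. x \<in> \<Omega> \<longrightarrow> f x = c"
  \<comment> \<open>Points are closed in a T1 space, so \<open>- {c}\<close> is open and its
    preimage under \<open>f\<close> is the trace on \<Omega> of an open set.\<close>
  obtain U where U: "open U" "U \<inter> \<Omega> = f -` (- {c}) \<inter> \<Omega>"
    using assms(2) unfolding continuous_on_open_invariant
    by (metis open_delete open_UNIV Compl_eq_Diff_UNIV)
  have "emeasure lebesgue (U \<inter> \<Omega>) = 0"
  proof -
    have "AE x in lebesgue. x \<notin> U \<inter> \<Omega>"
      using ae by eventually_elim (use U(2) in blast)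
    then show ?thesis
      using emeasure_eq_0_AE[of "\<lambda>x. x \<in> U \<inter> \<Omega>" lebesgue] by (simp add: Int_def)
  qed
  then have "U \<inter> \<Omega> = {}"
    using assms(1) U(1) unfolding full_support_def by force
  then show "\<forall>x\<in>\<Omega>. f x = c"
    using U(2) by blast
qed simp

text \<open>The integral sees \<open>f\<close> only up to null sets. Hence constancy is tied to
  \<open>full_support\<close>, while the last conjunct gives the criterion for equality that is
  valid without it.\<close>

theorem theorem3:
  fixes \<Omega> :: "(real ^ 'n) set"
    and f :: "real ^ 'n \<Rightarrow> real"
    and \<rho> :: "real \<Rightarrow> real"
    and fstar k :: real
  assumes "compact \<Omega>"
    and "emeasure lebesgue \<Omega> > 0"
    and "continuous_on \<Omega> f"
    and "fstar \<in> f ` \<Omega>" and "\<forall>x\<in>\<Omega>. fstar \<le> f x"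
    and "strict_antimono_on UNIV \<rho>"
    and "\<forall>x\<in>\<Omega>. \<rho> (f x) > 0"
  shows "(LINT x:\<Omega>|lebesgue. f x * min_density \<Omega> f \<rho> k x) \<ge> fstar
    \<and> (full_support \<Omega> \<longrightarrow>
        ((LINT x:\<Omega>|lebesgue. f x * min_density \<Omega> f \<rho> k x) = fstar \<longleftrightarrow> f constant_on \<Omega>))
    \<and> ((LINT x:\<Omega>|lebesgue. f x * min_density \<Omega> f \<rho> k x) = fstar \<longleftrightarrow>
        (AE x in lebesgue. x \<in> \<Omega> \<longrightarrow> f x = fstar))"
proof -
  let ?M = "lebesgue_on \<Omega>" and ?w = "\<lambda>x. \<rho> (f x) powr k"
  have lm: "\<Omega> \<in> lmeasurable"
    using assms(1) by (rule lmeasurable_compact)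
  then have \<Omega>: "\<Omega> \<in> sets lebesgue"
    by (rule fmeasurableD)
  \<comment> \<open>Over a finite measure, bounded measurable functions are integrable, so bounds on
    the weight and on \<open>f\<close> give the integrability needed below.\<close>
  interpret finite_measure ?M
    using lm by (rule finite_measure_lebesgue_on)
  have anti: "\<rho> y \<le> \<rho> x" if "x \<le> y" for x y
    using assms(6) that by (cases "x = y") (auto simp: monotone_on_def less_le)
  \<comment> \<open>An attained maximum of \<open>f\<close> yields the positive lower bound
    \<open>\<rho> (f z)\<close> for \<open>\<rho> (f x)\<close>, which controls negative
    powers.\<close>
  obtain z where z: "z \<in> \<Omega>" "\<And>x. x \<in> \<Omega> \<Longrightarrow> f x \<le> f z"
    using continuous_attains_sup[OF assms(1) _ assms(3)] assms(4) by blast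
  \<comment> \<open>On \<Omega> the base lies between \<open>\<rho> (f z)\<close> and
    \<open>\<rho> fstar\<close>. Its power is nondecreasing in the base for \<open>k \<ge> 0\<close>
    and decreasing for \<open>k < 0\<close>, so it is largest at one of these two ends.\<close>
  define B where "B = max (\<rho> fstar powr k) (\<rho> (f z) powr k)"
  have w_le: "?w x \<le> B" if x: "x \<in> \<Omega>" for x
  proof (cases "k \<ge> 0")
    case True
    have "\<rho> (f x) powr k \<le> \<rho> fstar powr k"
      using True x assms(5,7) anti by (intro powr_mono2) (auto simp: less_imp_le)
    then show ?thesis
      by (simp add: B_def)
  next
    case False
    have "\<rho> (f x) powr k \<le> \<rho> (f z) powr k"
      using False x z assms(7) anti by (intro powr_mono2') auto
    then show ?thesis
      by (simp add: B_def)
  qed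
  define F where "F = max \<bar>fstar\<bar> \<bar>f z\<bar>"
  have f_le: "\<bar>f x\<bar> \<le> F" if "x \<in> \<Omega>" for x
    using assms(5) z(2)[OF that] that unfolding F_def by force
  have f_meas [measurable]: "f \<in> borel_measurable ?M"
    using assms(3) \<Omega> by (rule continuous_imp_measurable_on_sets_lebesgue)
  have [measurable]: "\<rho> \<in> borel_measurable borel"
    using anti by (intro borel_measurable_antimono antimonoI)
  have w_int: "integrable ?M ?w"
    by (rule integrable_const_bound[where B = B]) (auto intro!: AE_I2 w_le)
  \<comment> \<open>The rule \<open>mult_mono\<close> also asks for \<open>0 \<le> F\<close>, which
    \<open>f_le\<close> gives at the point under consideration.\<close>
  have fw_int: "integrable ?M (\<lambda>x. f x * ?w x)"
    by (rule integrable_const_bound[where B = "F * B"])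
      (auto intro!: AE_I2 mult_mono w_le f_le order_trans[OF abs_ge_zero f_le] simp: abs_mult)
  have on: "(LINT x:\<Omega>|lebesgue. g x) = (\<integral>x. g x \<partial>?M)" for g :: "real ^ 'n \<Rightarrow> real"
    using \<Omega> by (simp add: set_lebesgue_integral_def integral_restrict_space)
  have pos: "?w x > 0" if "x \<in> space ?M" for x
    using assms(7) that by force
  have mass: "emeasure ?M (space ?M) > 0"
    using assms(2) \<Omega> by (simp add: emeasure_restrict_space)
  have ge: "fstar \<le> f x" if "x \<in> space ?M" for x
    using assms(5) that by simp
  note mean = weighted_mean_ge[OF w_int pos mass fw_int ge]
  have eq: "(LINT x:\<Omega>|lebesgue. f x * min_density \<Omega> f \<rho> k x)
      = (\<integral>x. f x * (?w x / integral\<^sup>L ?M ?w) \<partial>?M)"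
    by (simp only: on min_density_def tau_def)
  have AE_iff: "(LINT x:\<Omega>|lebesgue. f x * min_density \<Omega> f \<rho> k x) = fstar
      \<longleftrightarrow> (AE x in lebesgue. x \<in> \<Omega> \<longrightarrow> f x = fstar)"
    unfolding eq using mean(2) \<Omega> by (simp add: AE_restrict_space_iff)
  \<comment> \<open>Since \<open>fstar\<close> is itself a value of \<open>f\<close> on \<Omega>, it
    is the only possible constant.\<close>
  have "(\<forall>x\<in>\<Omega>. f x = fstar) \<longleftrightarrow> f constant_on \<Omega>"
    using assms(4) unfolding constant_on_def by (metis imageE)
  then have "(LINT x:\<Omega>|lebesgue. f x * min_density \<Omega> f \<rho> k x) = fstar \<longleftrightarrow> f constant_on \<Omega>"
    if "full_support \<Omega>"
    using AE_iff AE_eq_iff_of_full_support[OF that assms(3)] by simp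
  with AE_iff mean(1) show ?thesis
    unfolding eq by blast
qed

end
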